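(* Let $0\neq a=c_1+c_2\mathbf{j}\in Z(\mathbb{H}_s)$ and $0\neq b=u_1+u_2\mathbf{j}\in Z(\mathbb{H}_s)$ with $c_1,c_2,u_1,u_2\in\mathbb{C}$, and let $d\in\mathbb{H}_s$. Then the equation $axb=d$ (in the unknown $x\in\mathbb{H}_s$) is solvable if and only if $$\Big(1+\frac{c_2}{\overline{c_1}}\mathbf{j}\Big)d\Big(1+\frac{u_2}{u_1}\mathbf{j}\Big)=4d,$$ in which case all solutions are given by $$x=\frac{\overline{c_1}\,d\,\overline{u_1}}{4|c_1|^2|u_1|^2}+y-\frac14\Big(1+\frac{c_2}{c_1}\mathbf{j}\Big)y\Big(1+\frac{u_2}{\overline{u_1}}\mathbf{j}\Big),\qquad y\in\mathbb{H}_s \text{ arbitrary}.$$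
   Context: $\mathbb{H}_s=\{q_0+q_1\mathbf{i}+q_2\mathbf{j}+q_3\mathbf{k}: q_i\in\mathbb{R}\}$ is the real associative algebra of split quaternions with $\mathbf{i}^2=-1$, $\mathbf{j}^2=\mathbf{k}^2=1$, $\mathbf{i}\mathbf{j}=\mathbf{k}=-\mathbf{j}\mathbf{i}$, $\mathbf{j}\mathbf{k}=-\mathbf{i}=-\mathbf{k}\mathbf{j}$, $\mathbf{k}\mathbf{i}=\mathbf{j}=-\mathbf{i}\mathbf{k}$. $\mathbb{R}+\mathbb{R}\mathbf{i}$ is identified with $\mathbb{C}$; every $q\in\mathbb{H}_s$ is uniquely $q=z_1+z_2\mathbf{j}$ with $z_1=q_0+q_1\mathbf{i}$, $z_2=q_2+q_3\mathbf{i}\in\mathbb{C}$, and $\mathbf{j}z=\overline{z}\mathbf{j}$ for $z\in\mathbb{C}$. $I_q=q_0^2+q_1^2-q_2^2-q_3^2=|z_1|^2-|z_2|^2$, and $Z(\mathbb{H}_s)=\{q\in\mathbb{H}_s: I_q=0\}$. (For $0\ne q=z_1+z_2\mathbf{j}\in Z(\mathbb{H}_s)$ one has $z_1\neq0$, so the quotients make sense.) *)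

theory Defs
  imports Complex_Main
begin

codatatype split_quat = SplitQuat (Q0: real) (Q1: real) (Q2: real) (Q3: real)

lemma split_quat_eqI [intro?]:
  "\<lbrakk>Q0 x = Q0 y; Q1 x = Q1 y; Q2 x = Q2 y; Q3 x = Q3 y\<rbrakk> \<Longrightarrow> x = y"
  by (rule split_quat.expand) simp

lemma split_quat_eq_iff:
  "x = y \<longleftrightarrow> Q0 x = Q0 y \<and> Q1 x = Q1 y \<and> Q2 x = Q2 y \<and> Q3 x = Q3 y"
  by (auto intro: split_quat.expand)

instantiation split_quat :: ab_group_add
begin

primcorec zero_split_quat where
  "Q0 0 = 0" | "Q1 0 = 0" | "Q2 0 = 0" | "Q3 0 = 0"

primcorec plus_split_quat where
  "Q0 (x + y) = Q0 x + Q0 y"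
| "Q1 (x + y) = Q1 x + Q1 y"
| "Q2 (x + y) = Q2 x + Q2 y"
| "Q3 (x + y) = Q3 x + Q3 y"

primcorec uminus_split_quat where
  "Q0 (- x) = - Q0 x"
| "Q1 (- x) = - Q1 x"
| "Q2 (- x) = - Q2 x"
| "Q3 (- x) = - Q3 x"

primcorec minus_split_quat where
  "Q0 (x - y) = Q0 x - Q0 y"
| "Q1 (x - y) = Q1 x - Q1 y"
| "Q2 (x - y) = Q2 x - Q2 y"
| "Q3 (x - y) = Q3 x - Q3 y"

instance
  by standard (simp_all add: split_quat_eq_iff)

end

text \<open>The product is the bilinear extension of the multiplication table
  of the units, which is recovered in \<open>split_quat_table\<close> below.\<close>

instantiation split_quat :: real_algebra_1
begin

primcorec one_split_quat where
  "Q0 1 = 1" | "Q1 1 = 0" | "Q2 1 = 0" | "Q3 1 = 0"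

primcorec times_split_quat where
  "Q0 (x * y) = Q0 x * Q0 y - Q1 x * Q1 y + Q2 x * Q2 y + Q3 x * Q3 y"
| "Q1 (x * y) = Q0 x * Q1 y + Q1 x * Q0 y - Q2 x * Q3 y + Q3 x * Q2 y"
| "Q2 (x * y) = Q0 x * Q2 y + Q2 x * Q0 y - Q1 x * Q3 y + Q3 x * Q1 y"
| "Q3 (x * y) = Q0 x * Q3 y + Q3 x * Q0 y + Q1 x * Q2 y - Q2 x * Q1 y"

primcorec scaleR_split_quat where
  "Q0 (scaleR r x) = r * Q0 x"
| "Q1 (scaleR r x) = r * Q1 x"
| "Q2 (scaleR r x) = r * Q2 x"
| "Q3 (scaleR r x) = r * Q3 x"

instance
  by standard (simp_all add: split_quat_eq_iff algebra_simps)

end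

definition sq_i :: split_quat where "sq_i = SplitQuat 0 1 0 0"
definition sq_j :: split_quat where "sq_j = SplitQuat 0 0 1 0"
definition sq_k :: split_quat where "sq_k = SplitQuat 0 0 0 1"

lemma split_quat_table:
  "sq_i * sq_i = - 1" "sq_j * sq_j = 1" "sq_k * sq_k = 1"
  "sq_i * sq_j = sq_k" "sq_j * sq_i = - sq_k"
  "sq_j * sq_k = - sq_i" "sq_k * sq_j = sq_i"
  "sq_k * sq_i = sq_j" "sq_i * sq_k = - sq_j"
  by (simp_all add: split_quat_eq_iff sq_i_def sq_j_def sq_k_def)

lemma split_quat_basis:
  "q = Q0 q *\<^sub>R 1 + Q1 q *\<^sub>R sq_i + Q2 q *\<^sub>R sq_j + Q3 q *\<^sub>R sq_k"
  by (simp add: split_quat_eq_iff sq_i_def sq_j_def sq_k_def)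

text \<open>The identification of the complex numbers with the subalgebra
  spanned by \<open>1\<close> and \<open>sq_i\<close>.\<close>

definition sq_of_complex :: "complex \<Rightarrow> split_quat"
  where "sq_of_complex z = Re z *\<^sub>R 1 + Im z *\<^sub>R sq_i"

lemma sq_of_complex_sel [simp]:
  "Q0 (sq_of_complex z) = Re z" "Q1 (sq_of_complex z) = Im z"
  "Q2 (sq_of_complex z) = 0" "Q3 (sq_of_complex z) = 0"
  by (simp_all add: sq_of_complex_def sq_i_def)

lemma sq_of_complex_hom:
  "sq_of_complex 1 = 1" "sq_of_complex \<i> = sq_i"
  "sq_of_complex (w + z) = sq_of_complex w + sq_of_complex z"
  "sq_of_complex (w * z) = sq_of_complex w * sq_of_complex z"
  by (simp_all add: split_quat_eq_iff sq_i_def)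

lemma sq_j_times_complex: "sq_j * sq_of_complex z = sq_of_complex (cnj z) * sq_j"
  by (simp add: split_quat_eq_iff sq_j_def)

lemma split_quat_complex_decomp:
  "q = sq_of_complex z1 + sq_of_complex z2 * sq_j
    \<longleftrightarrow> z1 = Complex (Q0 q) (Q1 q) \<and> z2 = Complex (Q2 q) (Q3 q)"
  by (auto simp add: split_quat_eq_iff sq_j_def complex_eq_iff)

definition I_sq :: "split_quat \<Rightarrow> real"
  where "I_sq q = (Q0 q)\<^sup>2 + (Q1 q)\<^sup>2 - (Q2 q)\<^sup>2 - (Q3 q)\<^sup>2"

lemma I_sq_complex:
  "I_sq (sq_of_complex z1 + sq_of_complex z2 * sq_j) = (cmod z1)\<^sup>2 - (cmod z2)\<^sup>2"
  by (simp add: I_sq_def sq_j_def cmod_power2)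

definition Z_sq :: "split_quat set"
  where "Z_sq = {q. I_sq q = 0}"

end

theory Submission
  imports Defs
begin

text \<open>A nonzero zero divisor \<open>a = c\<^sub>1 + c\<^sub>2 j\<close> has \<open>\<bar>c\<^sub>1\<bar> = \<bar>c\<^sub>2\<bar> \<noteq> 0\<close>.  Pulling the unit \<open>c\<^sub>1\<close> out
  on the left or on the right, and moving it past \<open>j\<close> with \<open>j z = cnj z j\<close>, gives
  \<open>a = c\<^sub>1 e = p c\<^sub>1\<close> with \<open>e = 1 + (c\<^sub>2 / c\<^sub>1) j\<close> and \<open>p = 1 + (c\<^sub>2 / cnj c\<^sub>1) j\<close>.  The coefficient of
  \<open>j\<close> has modulus one in both, which makes \<open>e\<close> and \<open>p\<close> twice an idempotent.  In the same way
  \<open>b = f u\<^sub>1 = u\<^sub>1 r\<close>.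

  So \<open>a x b = p (c\<^sub>1 x u\<^sub>1) r\<close> ranges over the image of the projection
  \<open>d \<mapsto> p d r / 4\<close>, and \<open>d\<close> lies in this image iff the projection fixes it.  Moreover
  \<open>a x b = c\<^sub>1 (e x f) u\<^sub>1\<close> with invertible outer factors, so solving for \<open>x\<close> means prescribing the
  value of the projection \<open>x \<mapsto> e x f / 4\<close>, and the solutions form a translate of its kernel,
  which is the image of \<open>y \<mapsto> y - e y f / 4\<close>.  This argument works in every unital real algebra;
  \<open>sandwich_solvable_iff\<close> and \<open>sandwich_solutions\<close> state it there.\<close>

text \<open>Necessity holds because \<open>p * a = 2 a\<close> and \<open>b * r = 2 b\<close>; for sufficiency the solution is
  obtained by undoing the units and dividing by the factor 4 that the two doubled idempotents
  contribute.\<close>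

lemma sandwich_solvable_iff:
  fixes a b c c' d p r u u' :: "'a::real_algebra_1"
  assumes a: "a = p * c" and b: "b = u * r"
    and p: "p * p = 2 *\<^sub>R p" and r: "r * r = 2 *\<^sub>R r"
    and c: "c * c' = 1" and u: "u' * u = 1"
  shows "(\<exists>x. a * x * b = d) \<longleftrightarrow> p * d * r = 4 *\<^sub>R d"
proof
  assume "\<exists>x. a * x * b = d"
  then obtain x where x: "a * x * b = d" ..
  have "p * d * r = (p * p) * (c * x * u) * (r * r)"
    by (simp add: x[symmetric] a b mult.assoc)
  also have "\<dots> = 4 *\<^sub>R (p * (c * x * u) * r)"
    by (simp add: p r)
  also have "\<dots> = 4 *\<^sub>R d"
    by (simp add: x[symmetric] a b mult.assoc)
  finally show "p * d * r = 4 *\<^sub>R d" .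
next
  assume d: "p * d * r = 4 *\<^sub>R d"
  have "a * ((1 / 4) *\<^sub>R (c' * d * u')) * b = (1 / 4) *\<^sub>R (p * (c * c') * d * (u' * u) * r)"
    by (simp add: a b mult.assoc)
  also have "\<dots> = d"
    by (simp add: c u d)
  finally show "\<exists>x. a * x * b = d" ..
qed

text \<open>Applying \<open>c'\<close> and \<open>u'\<close> to the equation turns it into \<open>e x f = c' d u'\<close>.  Hence a solution \<open>x\<close>
  is recovered from the parameter \<open>y = x\<close>, and the part of the right-hand side that depends on
  \<open>y\<close> solves the homogeneous equation since \<open>e (y - e y f / 4) f = 0\<close>.\<close>

lemma sandwich_solutions:
  fixes a b c c' d e f u u' :: "'a::real_algebra_1"
  assumes a: "a = c * e" and b: "b = f * u"
    and e: "e * e = 2 *\<^sub>R e" and f: "f * f = 2 *\<^sub>R f"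
    and c: "c' * c = 1" and u: "u * u' = 1"
    and solvable: "\<exists>x. a * x * b = d"
  shows "{x. a * x * b = d} =
    {(1 / 4) *\<^sub>R (c' * d * u') + y - (1 / 4) *\<^sub>R (e * y * f) | y. True}"
proof -
  have cdu: "c' * d * u' = e * x * f" if "a * x * b = d" for x
  proof -
    have "c' * d * u' = (c' * c) * e * x * f * (u * u')"
      by (simp add: that[symmetric] a b mult.assoc)
    then show ?thesis
      by (simp add: c u)
  qed
  have sandwich: "a * (e * y * f) * b = 4 *\<^sub>R (a * y * b)" for y
  proof -
    have "a * (e * y * f) * b = c * (e * e) * y * (f * f) * u"
      by (simp add: a b mult.assoc)
    also have "\<dots> = 4 *\<^sub>R (a * y * b)"
      by (simp add: e f a b mult.assoc)
    finally show ?thesis .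
  qed
  obtain x0 where x0: "a * x0 * b = d"
    using solvable ..
  have "a * ((1 / 4) *\<^sub>R (c' * d * u') + y - (1 / 4) *\<^sub>R (e * y * f)) * b = d" for y
  proof -
    have "a * ((1 / 4) *\<^sub>R (c' * d * u') + y - (1 / 4) *\<^sub>R (e * y * f)) * b =
        (1 / 4) *\<^sub>R (a * (e * x0 * f) * b) + a * y * b - (1 / 4) *\<^sub>R (a * (e * y * f) * b)"
      by (simp only: cdu[OF x0] distrib_left distrib_right left_diff_distrib right_diff_distrib
          mult_scaleR_left mult_scaleR_right)
    also have "\<dots> = d"
      by (simp add: sandwich x0)
    finally show ?thesis .
  qed
  moreover have "x = (1 / 4) *\<^sub>R (c' * d * u') + x - (1 / 4) *\<^sub>R (e * x * f)"
    if "a * x * b = d" for x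
    by (simp add: cdu[OF that])
  ultimately show ?thesis
    by blast
qed

lemma complex_parts_of_zero_divisor:
  assumes "a = sq_of_complex c1 + sq_of_complex c2 * sq_j" and "a \<noteq> 0" and "a \<in> Z_sq"
  shows "c1 \<noteq> 0" and "cmod c2 = cmod c1"
proof -
  have "(cmod c1)\<^sup>2 = (cmod c2)\<^sup>2"
    using assms by (simp add: Z_sq_def I_sq_complex)
  then show eq: "cmod c2 = cmod c1"
    by simp
  show "c1 \<noteq> 0"
  proof
    assume "c1 = 0"
    with eq have "a = 0"
      using assms(1) by (simp add: split_quat_eq_iff)
    with assms(2) show False ..
  qed
qed

text \<open>If \<open>\<bar>z\<bar> = 1\<close>, then \<open>(z j)\<^sup>2 = z (cnj z) j\<^sup>2 = 1\<close>, so squaring \<open>1 + z j\<close> doubles it.\<close>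

lemma one_plus_unimodular_j_squared:
  assumes "cmod z = 1"
  shows "(1 + sq_of_complex z * sq_j) * (1 + sq_of_complex z * sq_j)
    = 2 *\<^sub>R (1 + sq_of_complex z * sq_j)"
proof -
  have "Re z * Re z + Im z * Im z = 1"
    using assms cmod_power2[of z] by (simp add: power2_eq_square)
  then show ?thesis
    by (simp add: split_quat_eq_iff sq_j_def algebra_simps)
qed

lemma factor_complex_left:
  assumes "c \<noteq> 0"
  shows "sq_of_complex c + sq_of_complex w * sq_j
    = sq_of_complex c * (1 + sq_of_complex (w / c) * sq_j)"
  using assms
  by (simp add: distrib_left mult.assoc[symmetric] sq_of_complex_hom(4)[symmetric])

text \<open>The conjugate in the denominator compensates for the one that appears when \<open>c\<close> passes \<open>j\<close>.\<close>

lemma factor_complex_right: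
  assumes "c \<noteq> 0"
  shows "sq_of_complex c + sq_of_complex w * sq_j
    = (1 + sq_of_complex (w / cnj c) * sq_j) * sq_of_complex c"
proof -
  have "sq_of_complex (w / cnj c) * sq_j * sq_of_complex c
      = sq_of_complex (w / cnj c * cnj c) * sq_j"
    by (simp only: mult.assoc sq_j_times_complex sq_of_complex_hom(4))
  then show ?thesis
    using assms by (simp add: distrib_right)
qed

lemma sq_of_complex_inverse:
  "sq_of_complex (inverse c) = (1 / (cmod c)\<^sup>2) *\<^sub>R sq_of_complex (cnj c)"
  by (simp add: split_quat_eq_iff cmod_power2)

theorem theorem3p1:
  fixes a b d :: split_quat and c1 c2 u1 u2 :: complex
  assumes "a = sq_of_complex c1 + sq_of_complex c2 * sq_j"
    and "a \<noteq> 0" and "a \<in> Z_sq"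
    and "b = sq_of_complex u1 + sq_of_complex u2 * sq_j"
    and "b \<noteq> 0" and "b \<in> Z_sq"
  shows "((\<exists>x. a * x * b = d) \<longleftrightarrow>
      (1 + sq_of_complex (c2 / cnj c1) * sq_j) * d * (1 + sq_of_complex (u2 / u1) * sq_j) = 4 * d)
    \<and> ((\<exists>x. a * x * b = d) \<longrightarrow>
      {x. a * x * b = d} =
        {(1 / (4 * (cmod c1)\<^sup>2 * (cmod u1)\<^sup>2)) *\<^sub>R
            (sq_of_complex (cnj c1) * d * sq_of_complex (cnj u1))
          + y
          - (1 / 4) *\<^sub>R ((1 + sq_of_complex (c2 / c1) * sq_j) * y
              * (1 + sq_of_complex (u2 / cnj u1) * sq_j)) | y. True})"
proof -
  note c = complex_parts_of_zero_divisor[OF assms(1-3)]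
  note u = complex_parts_of_zero_divisor[OF assms(4-6)]
  have moduli: "cmod (c2 / c1) = 1" "cmod (c2 / cnj c1) = 1"
      "cmod (u2 / u1) = 1" "cmod (u2 / cnj u1) = 1"
    using c u by (simp_all add: norm_divide)
  have inv: "sq_of_complex z * sq_of_complex (inverse z) = 1"
      "sq_of_complex (inverse z) * sq_of_complex z = 1" if "z \<noteq> 0" for z
    using that by (simp_all add: sq_of_complex_hom(4)[symmetric] sq_of_complex_hom(1))
  note a_left = assms(1)[unfolded factor_complex_left[OF c(1)]]
  note a_right = assms(1)[unfolded factor_complex_right[OF c(1)]]
  note b_left = assms(4)[unfolded factor_complex_left[OF u(1)]]
  note b_right = assms(4)[unfolded factor_complex_right[OF u(1)]]
  have four: "4 * d = 4 *\<^sub>R d"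
    by (simp add: scaleR_conv_of_real)
  have particular: "(1 / (4 * (cmod c1)\<^sup>2 * (cmod u1)\<^sup>2)) *\<^sub>R
        (sq_of_complex (cnj c1) * d * sq_of_complex (cnj u1))
      = (1 / 4) *\<^sub>R (sq_of_complex (inverse c1) * d * sq_of_complex (inverse u1))"
    by (simp add: sq_of_complex_inverse mult.commute)
  show ?thesis
    unfolding four particular
    using sandwich_solvable_iff[OF a_right b_left
        one_plus_unimodular_j_squared[OF moduli(2)] one_plus_unimodular_j_squared[OF moduli(3)]
        inv(1)[OF c(1)] inv(2)[OF u(1)], of d]
      sandwich_solutions[OF a_left b_right
        one_plus_unimodular_j_squared[OF moduli(1)] one_plus_unimodular_j_squared[OF moduli(4)]
        inv(2)[OF c(1)] inv(1)[OF u(1)], of d]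
    by (intro conjI impI)
qed

end
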